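(* Let $k,r,n,s\in\mathbb{N}$ and let $a_1,\ldots,a_k\in\mathbb{Z}$ satisfy $(a_i,n^s)_s=1$ for $i=1,\ldots,k$. Then $$\sum_{\substack{1\le m_1,\ldots,m_k\le n^s\\ (m_i,n^s)_s=1\ (i=1,\ldots,k)\\ 1\le b_1,\ldots,b_r\le n^s}} (m_1-a_1,\ldots,m_k-a_k,b_1,\ldots,b_r,n^s)_s \;=\; \Phi_s(n^s)^k\sum_{d^s\mid n^s}\frac{(d^s)^r}{\Phi_s\!\left(\frac{n^s}{d^s}\right)^{k-1}},$$ where the sum on the left is over integers $m_1,\ldots,m_k,b_1,\ldots,b_r$ in the indicated ranges, and the sum on the right is over positive integers $d$ with $d^s\mid n^s$.
   Context: $\mathbb{N}$ denotes the positive integers. For a positive integer $s$ and integers not all zero, $(x_1,\ldots,x_m)_s$ denotes the largest $l^s$ with $l\in\mathbb{N}$ dividing all of $x_1,\ldots,x_m$ (generalized gcd; for $s=1$ it is the usual gcd). Klee's function $\Phi_s(n)$, for $s,n\in\mathbb{N}$, is the number of integers $m$ with $1\le m\le n$ and $(m,n)_s=1$; equivalently $\Phi_s(n)=n\prod_{p\text{ prime},\,p^s\mid n}(1-p^{-s})$. *)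

theory Defs
  imports Complex_Main "HOL-Library.FuncSet"
begin

text \<open>
  The value is only meaningful for \<open>s \<ge> 1\<close> and \<open>X\<close> containing a nonzero integer: then the set under
  \<^const>\<open>Max\<close> is finite, and it contains \<open>1\<close>. A tuple is represented by the set of its entries.
\<close>

definition gen_gcd :: "nat \<Rightarrow> int set \<Rightarrow> nat" where
  "gen_gcd s X = Max {l ^ s |l::nat. l \<ge> 1 \<and> (\<forall>x\<in>X. int (l ^ s) dvd x)}"

definition klee :: "nat \<Rightarrow> nat \<Rightarrow> nat" where
  "klee s n = card {m::int. 1 \<le> m \<and> m \<le> int n \<and> gen_gcd s {m, int n} = 1}"

end

theory Submission
  imports Defs "HOL-Number_Theory.Number_Theory"
begin

text \<open>
  Write \<open>N = n\<^sup>s\<close> and \<open>\<phi>(d) = \<Phi>\<^sub>s(d\<^sup>s)\<close>. As \<open>\<Sum>\<^bsub>d | L\<^esub> \<phi>(d) = L\<^sup>s\<close>, the generalized gcd in the summand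
  is the sum of \<open>\<phi>(d)\<close> over those \<open>d | n\<close> for which \<open>d\<^sup>s\<close> divides all the entries. After exchanging
  the sums, the \<open>b\<^sub>j\<close> contribute \<open>(N / d\<^sup>s)\<^sup>r\<close>, and each \<open>m\<^sub>i\<close> contributes the number of \<open>x \<le> N\<close> with
  \<open>(x, N)\<^sub>s = 1\<close> and \<open>x \<equiv> a\<^sub>i (mod d\<^sup>s)\<close>. This number is \<open>\<phi>(n) / \<phi>(d)\<close>, because it is the same for all
  classes \<open>a\<close> with \<open>(a, d\<^sup>s)\<^sub>s = 1\<close>: two such classes are exchanged by a translation by some \<open>t\<close>
  divisible by \<open>p\<^sup>s\<close> for every prime \<open>p\<close> that divides \<open>n\<close> but not \<open>d\<close>. Replacing \<open>d\<close> by \<open>n / d\<close> gives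
  the right-hand side.
\<close>

section \<open>Generalized gcds as s-th powers of divisors\<close>

lemma lcm_power_nat:
  fixes l m s :: nat
  shows "lcm (l ^ s) (m ^ s) = lcm l m ^ s"
proof (cases "gcd l m = 0")
  case False
  have "lcm (l ^ s) (m ^ s) * gcd l m ^ s = lcm l m ^ s * gcd l m ^ s"
    by (metis gcd_exp mult.commute power_mult_distrib prod_gcd_lcm_nat)
  then show ?thesis using False by (metis mult_right_cancel power_not_zero)
\<comment> \<open>Here \<open>l\<close> and \<open>m\<close> are both 0; \<open>s = 0\<close> is
  treated apart because \<open>0 ^ 0 = 1\<close>.\<close>
qed (cases s; simp)

lemma lcm_power_dvd_int:
  fixes l m s :: nat and x :: int
  assumes "int (l ^ s) dvd x" "int (m ^ s) dvd x"
  shows "int (lcm l m ^ s) dvd x"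
proof -
  have "l ^ s dvd nat \<bar>x\<bar>" "m ^ s dvd nat \<bar>x\<bar>"
    using assms by (metis int_dvd_int_iff dvd_abs_iff nat_0_le abs_ge_zero)+
  then have "lcm l m ^ s dvd nat \<bar>x\<bar>"
    by (metis lcm_least lcm_power_nat)
  then show ?thesis
    by (metis int_dvd_int_iff dvd_abs_iff nat_0_le abs_ge_zero)
qed

text \<open>The admissible \<open>l\<close> all divide \<open>n\<close> and are closed under lcm, so
  their maximum \<open>L\<close> is a multiple of each of them. This turns a definition by size into
  one by divisibility.\<close>

lemma gen_gcd_root:
  assumes "s \<ge> 1" "n \<ge> 1"
  obtains L where "L dvd n" "gen_gcd s (insert (int (n ^ s)) X) = L ^ s"
    "\<And>l. l dvd n \<Longrightarrow> (\<forall>x\<in>X. int (l ^ s) dvd x) \<longleftrightarrow> l dvd L"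
proof -
  define S where "S = {l. l \<ge> 1 \<and> (\<forall>x\<in>insert (int (n ^ s)) X. int (l ^ s) dvd x)}"
  have dvd_n: "l dvd n" if "l \<in> S" for l
  proof -
    have "l ^ s dvd n ^ s" using that unfolding S_def by (simp only: mem_Collect_eq ball_simps int_dvd_int_iff)
    then show ?thesis using assms by simp
  qed
  have fin: "finite S"
    by (rule finite_subset[of _ "{l. l dvd n}"]) (use dvd_n assms in auto)
  have ne: "1 \<in> S" by (simp add: S_def)
  define L where "L = Max S"
  have L: "L \<in> S" unfolding L_def using fin ne by (intro Max_in) auto
  have le_L: "l \<le> L" if "l \<in> S" for l
    unfolding L_def using fin that by simp
  have dvd_L: "l dvd L" if "l \<in> S" for l
  proof -
    have "lcm l L \<in> S"
      unfolding S_def mem_Collect_eq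
    proof (intro conjI ballI)
      show "1 \<le> lcm l L" using that L lcm_pos_nat[of l L] by (simp add: S_def Suc_le_eq)
      fix x assume "x \<in> insert (int (n ^ s)) X"
      then have "int (l ^ s) dvd x" "int (L ^ s) dvd x" using that L unfolding S_def by blast+
      then show "int (lcm l L ^ s) dvd x" by (rule lcm_power_dvd_int)
    qed
    then have "lcm l L \<le> L" by (rule le_L)
    moreover have "L dvd lcm l L" "lcm l L > 0" using that L by (auto simp: S_def intro!: lcm_pos_nat)
    ultimately have "lcm l L = L" by (meson dvd_imp_le le_antisym)
    then show ?thesis by (metis dvd_lcm1)
  qed
  have "gen_gcd s (insert (int (n ^ s)) X) = Max ((\<lambda>l. l ^ s) ` S)"
    unfolding gen_gcd_def S_def by (rule arg_cong[of _ _ Max]) blast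
  also have "\<dots> = L ^ s"
    using fin L le_L by (intro Max_eqI) (auto intro: power_mono)
  finally have "gen_gcd s (insert (int (n ^ s)) X) = L ^ s" .
  moreover have "(\<forall>x\<in>X. int (l ^ s) dvd x) \<longleftrightarrow> l dvd L" if "l dvd n" for l
  proof
    assume "\<forall>x\<in>X. int (l ^ s) dvd x"
    moreover have "l \<ge> 1" using that assms by (cases "l = 0") auto
    moreover have "int (l ^ s) dvd int (n ^ s)" using that by (simp only: int_dvd_int_iff dvd_power_same)
    ultimately have "l \<in> S" by (auto simp: S_def simp del: of_nat_power)
    then show "l dvd L" by (rule dvd_L)
  next
    assume "l dvd L"
    then have "int (l ^ s) dvd int (L ^ s)" by (simp only: int_dvd_int_iff dvd_power_same)
    then show "\<forall>x\<in>X. int (l ^ s) dvd x"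
      using L unfolding S_def by (blast intro: dvd_trans)
  qed
  ultimately show ?thesis using that dvd_n[OF L] by blast
qed

text \<open>The root \<open>L\<close> is 1 exactly when no prime divides it, and its prime divisors
  are the primes \<open>p\<close> dividing \<open>n\<close> with \<open>p ^ s\<close> dividing
  \<open>x\<close>. Coprimality can thus be checked one prime at a time.\<close>

lemma gen_gcd_eq_1_iff:
  assumes "s \<ge> 1" "n \<ge> 1"
  shows "gen_gcd s {x, int (n ^ s)} = 1 \<longleftrightarrow> (\<forall>p. prime p \<longrightarrow> p dvd n \<longrightarrow> \<not> int (p ^ s) dvd x)"
proof -
  obtain L where L: "L dvd n" "gen_gcd s {int (n ^ s), x} = L ^ s"
    "\<And>l. l dvd n \<Longrightarrow> int (l ^ s) dvd x \<longleftrightarrow> l dvd L"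
    using gen_gcd_root[OF assms, of "{x}"] by auto
  have "gen_gcd s {x, int (n ^ s)} = 1 \<longleftrightarrow> L = 1"
    using L(2) assms by (simp add: insert_commute power_eq_1_iff)
  also have "\<dots> \<longleftrightarrow> (\<forall>p. prime p \<longrightarrow> \<not> p dvd L)"
    by (metis not_prime_1 prime_factor_nat nat_dvd_1_iff_1)
  also have "\<dots> \<longleftrightarrow> (\<forall>p. prime p \<longrightarrow> p dvd n \<longrightarrow> \<not> int (p ^ s) dvd x)"
    using L(1,3) dvd_trans by blast
  finally show ?thesis .
qed

section \<open>Klee residues and the divisor sum of Klee's function\<close>

definition klee_residues :: "nat \<Rightarrow> nat \<Rightarrow> int set" where
  "klee_residues s n = {x. 1 \<le> x \<and> x \<le> int (n ^ s) \<and> gen_gcd s {x, int (n ^ s)} = 1}"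

lemma finite_klee_residues [simp]: "finite (klee_residues s n)"
  by (rule finite_subset[of _ "{1..int (n ^ s)}"]) (auto simp: klee_residues_def)

lemma klee_power: "klee s (n ^ s) = card (klee_residues s n)"
  by (simp add: klee_def klee_residues_def)

text \<open>The residue 1 is always counted. Positivity permits the later divisions by values of
  Klee's function.\<close>

lemma klee_power_pos:
  assumes "s \<ge> 1" "n \<ge> 1"
  shows "klee s (n ^ s) > 0"
proof -
  have "\<not> int (p ^ s) dvd 1" if "prime p" for p
    using that assms prime_gt_1_nat[OF that] by (simp add: power_eq_1_iff del: of_nat_power)
  then have "gen_gcd s {1, int (n ^ s)} = 1"
    unfolding gen_gcd_eq_1_iff[OF assms] by blast
  then have "1 \<in> klee_residues s n"
    using assms by (simp add: klee_residues_def)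
  then show ?thesis unfolding klee_power by (auto simp: card_gt_0_iff)
qed

text \<open>Multiplying both entries by \<open>e ^ s\<close> multiplies their generalized gcd by
  \<open>e ^ s\<close>, so the numbers with gcd \<open>e ^ s\<close> are a scaled copy of the
  residues for the cofactor \<open>m\<close>.\<close>

lemma klee_residues_power_shift:
  assumes "s \<ge> 1" "e \<ge> 1" "m \<ge> 1"
  shows "{x \<in> {1..int ((e * m) ^ s)}. gen_gcd s {x, int ((e * m) ^ s)} = e ^ s}
       = (\<lambda>y. int (e ^ s) * y) ` klee_residues s m"
proof -
  have eq: "gen_gcd s {int (e ^ s) * y, int ((e * m) ^ s)} = e ^ s \<longleftrightarrow> gen_gcd s {y, int (m ^ s)} = 1" for y
  proof -
    obtain L where L: "L dvd e * m" "gen_gcd s {int ((e * m) ^ s), int (e ^ s) * y} = L ^ s"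
      "\<And>l. l dvd e * m \<Longrightarrow> int (l ^ s) dvd int (e ^ s) * y \<longleftrightarrow> l dvd L"
      using gen_gcd_root[OF assms(1), of "e * m" "{int (e ^ s) * y}"] assms by auto
    obtain M where M: "M dvd m" "gen_gcd s {int (m ^ s), y} = M ^ s"
      "\<And>l. l dvd m \<Longrightarrow> int (l ^ s) dvd y \<longleftrightarrow> l dvd M"
      using gen_gcd_root[OF assms(1,3), of "{y}"] by auto
    have "e dvd L" using L(3)[of e] by simp
    then obtain L' where L': "L = e * L'" by blast
    \<comment> \<open>Cancelling \<open>e ^ s\<close> compares the two roots: \<open>L'\<close> and
      \<open>M\<close> divide \<open>m\<close> and have the same divisors, hence are equal.\<close>
    have "l dvd L' \<longleftrightarrow> l dvd M" if "l dvd m" for l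
      using L(3)[of "e * l"] M(3)[OF that] that assms by (simp add: L' power_mult_distrib)
    moreover have "L' dvd m" using L(1) assms by (simp add: L')
    ultimately have "L' = M" using M(1) by (meson dvd_antisym dvd_refl)
    then show ?thesis
      using L(2) M(2) assms by (simp add: insert_commute L' power_mult_distrib power_eq_1_iff)
  qed
  show ?thesis
  proof (intro equalityI subsetI)
    fix x assume x: "x \<in> {x \<in> {1..int ((e * m) ^ s)}. gen_gcd s {x, int ((e * m) ^ s)} = e ^ s}"
    obtain L where L: "gen_gcd s {int ((e * m) ^ s), x} = L ^ s"
      "\<And>l. l dvd e * m \<Longrightarrow> int (l ^ s) dvd x \<longleftrightarrow> l dvd L"
      using gen_gcd_root[OF assms(1), of "e * m" "{x}"] assms by auto
    have "L ^ s = e ^ s" using L(1) x by (simp add: insert_commute)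
    then have "L = e" using assms by (simp add: power_eq_iff_eq_base)
    then have "int (e ^ s) dvd x" using L(2)[of e] by simp
    then obtain y where y: "x = int (e ^ s) * y" by blast
    have "y \<in> klee_residues s m"
      using x assms eq[of y] by (auto simp: klee_residues_def y power_mult_distrib zero_less_mult_iff int_one_le_iff_zero_less)
    then show "x \<in> (\<lambda>y. int (e ^ s) * y) ` klee_residues s m" using y by blast
  next
    fix x assume "x \<in> (\<lambda>y. int (e ^ s) * y) ` klee_residues s m"
    then obtain y where y: "y \<in> klee_residues s m" "x = int (e ^ s) * y" by blast
    then show "x \<in> {x \<in> {1..int ((e * m) ^ s)}. gen_gcd s {x, int ((e * m) ^ s)} = e ^ s}"
      using eq[of y] assms
      by (auto simp: klee_residues_def power_mult_distrib int_one_le_iff_zero_less)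
  qed
qed

lemma sum_divisors_complement:
  fixes f :: "nat \<Rightarrow> 'a::comm_monoid_add"
  assumes "n \<ge> 1"
  shows "(\<Sum>d | d dvd n. f (n div d)) = (\<Sum>d | d dvd n. f d)"
  by (rule sum.reindex_bij_witness[of _ "\<lambda>d. n div d" "\<lambda>d. n div d"])
     (use assms in \<open>auto simp: dvd_div_eq_mult elim!: dvdE\<close>)

text \<open>The analogue of Gauss's identity for the totient: the numbers up to \<open>n ^ s\<close>
  are sorted by their generalized gcd \<open>e ^ s\<close> with \<open>n ^ s\<close>, and each class
  is counted by scaling.\<close>

lemma sum_klee_divisors:
  assumes "s \<ge> 1" "n \<ge> 1"
  shows "(\<Sum>d | d dvd n. klee s (d ^ s)) = n ^ s"
proof -
  define F where "F e = {x \<in> {1..int (n ^ s)}. gen_gcd s {x, int (n ^ s)} = e ^ s}" for e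
  have "{1..int (n ^ s)} = (\<Union>e\<in>{e. e dvd n}. F e)"
  proof (intro equalityI subsetI)
    fix x assume x: "x \<in> {1..int (n ^ s)}"
    obtain L where "L dvd n" "gen_gcd s {int (n ^ s), x} = L ^ s"
      using gen_gcd_root[OF assms, of "{x}"] by metis
    then show "x \<in> (\<Union>e\<in>{e. e dvd n}. F e)"
      using x by (auto simp: F_def insert_commute)
  qed (auto simp: F_def)
  then have "n ^ s = card (\<Union>e\<in>{e. e dvd n}. F e)"
    by (metis card_atLeastAtMost_int diff_add_cancel nat_int)
  also have "\<dots> = (\<Sum>e | e dvd n. card (F e))"
  proof (rule card_UN_disjoint)
    have "e = e'" if "e ^ s = e' ^ s" for e e' :: nat
      using that assms by (simp add: power_eq_iff_eq_base)
    then show "\<forall>e\<in>{e. e dvd n}. \<forall>e'\<in>{e. e dvd n}. e \<noteq> e' \<longrightarrow> F e \<inter> F e' = {}"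
      by (auto simp: F_def)
  qed (use assms in \<open>simp_all add: F_def del: atLeastAtMost_iff\<close>)
  also have "\<dots> = (\<Sum>e | e dvd n. klee s ((n div e) ^ s))"
  proof (rule sum.cong)
    fix e assume "e \<in> {e. e dvd n}"
    then obtain m where m: "n = e * m" by auto
    then have pos: "e \<ge> 1" "m \<ge> 1" using assms by (auto simp: Suc_le_eq intro: Nat.gr0I)
    have "F e = (\<lambda>y. int (e ^ s) * y) ` klee_residues s m"
      unfolding F_def m using klee_residues_power_shift[OF assms(1) pos] .
    moreover have "inj_on (\<lambda>y. int (e ^ s) * y) (klee_residues s m)"
      using pos by (auto simp: inj_on_def)
    ultimately show "card (F e) = klee s ((n div e) ^ s)"
      using pos by (simp add: m klee_power card_image)
  qed simp
  also have "\<dots> = (\<Sum>d | d dvd n. klee s (d ^ s))"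
    by (rule sum_divisors_complement[OF assms(2)])
  finally show ?thesis by simp
qed

section \<open>Equidistribution of Klee residues among the admissible classes\<close>

lemma shift_mod_properties:
  fixes N x :: int
  assumes "N > 0"
  shows "1 \<le> (x - 1) mod N + 1" "(x - 1) mod N + 1 \<le> N" "N dvd ((x - 1) mod N + 1) - x"
proof -
  show "1 \<le> (x - 1) mod N + 1" "(x - 1) mod N + 1 \<le> N"
    using assms pos_mod_sign[of N "x - 1"] pos_mod_bound[of N "x - 1"] by linarith+
  have "((x - 1) mod N + 1) - x = - (N * ((x - 1) div N))"
    by (simp add: minus_div_mult_eq_mod [symmetric] algebra_simps)
  then show "N dvd ((x - 1) mod N + 1) - x" by simp
qed

text \<open>Translation by \<open>t\<close>, reduced modulo \<open>n ^ s\<close>, injects one class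
  into the other. The hypotheses are symmetric in \<open>a\<close> and \<open>a'\<close>, so one
  inequality yields equality.\<close>

lemma card_klee_residues_class_le:
  assumes "s \<ge> 1" "n \<ge> 1" "d dvd n"
    and a: "gen_gcd s {a, int (d ^ s)} = 1" and a': "gen_gcd s {a', int (d ^ s)} = 1"
  shows "card {x \<in> klee_residues s n. int (d ^ s) dvd x - a}
       \<le> card {x \<in> klee_residues s n. int (d ^ s) dvd x - a'}"
proof -
  define q where "q = \<Prod>{p. prime p \<and> p dvd n \<and> \<not> p dvd d}"
  have finP: "finite {p. prime p \<and> p dvd n \<and> \<not> p dvd d}"
    by (rule finite_subset[of _ "{p. p dvd n}"]) (use assms in auto)
  have "coprime q d" unfolding q_def
    by (rule prod_coprime_left) (auto intro: prime_imp_coprime)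
  then have "coprime (int (d ^ s)) (int (q ^ s))"
    by (simp only: coprime_int_iff) (simp add: coprime_commute)
  \<comment> \<open>The first congruence moves the class of \<open>a\<close> to that of
    \<open>a'\<close>; the second leaves residues unchanged modulo \<open>p ^ s\<close> for the
    primes \<open>p\<close> of \<open>n\<close> not dividing \<open>d\<close>.\<close>
  then obtain t where t: "[t = a' - a] (mod int (d ^ s))" "[t = 0] (mod int (q ^ s))"
    using binary_chinese_remainder_int by blast
  have t_d: "int (d ^ s) dvd t - (a' - a)" using t(1) by (simp add: cong_iff_dvd_diff)
  have t_p: "int (p ^ s) dvd t" if "prime p" "p dvd n" "\<not> p dvd d" for p
  proof -
    have "p dvd q" unfolding q_def using that finP by (intro dvd_prodI) auto
    then have "int (p ^ s) dvd int (q ^ s)" by (simp only: int_dvd_int_iff dvd_power_same)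
    moreover have "int (q ^ s) dvd t" using t(2) by (simp add: cong_0_iff)
    ultimately show ?thesis by (rule dvd_trans)
  qed
  define N where "N = int (n ^ s)"
  have N: "N > 0" using assms by (simp add: N_def)
  have dN: "int (e ^ s) dvd N" if "e dvd n" for e
    unfolding N_def using that by (simp only: int_dvd_int_iff dvd_power_same)
  have d1: "d \<ge> 1" using assms by (cases "d = 0") auto
  \<comment> \<open>The shift by 1 selects representatives in 1, ..., \<open>N\<close> instead of 0,
    ..., \<open>N - 1\<close>.\<close>
  define f where "f x = (x + t - 1) mod N + 1" for x
  have f: "1 \<le> f x" "f x \<le> N" "N dvd f x - (x + t)" for x
    unfolding f_def using shift_mod_properties[OF N, of "x + t"] by auto
  show ?thesis
  proof (rule card_inj_on_le[of f])
    show "inj_on f {x \<in> klee_residues s n. int (d ^ s) dvd x - a}"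
    proof (rule inj_onI)
      fix x y assume "x \<in> {x \<in> klee_residues s n. int (d ^ s) dvd x - a}"
        "y \<in> {x \<in> klee_residues s n. int (d ^ s) dvd x - a}" "f x = f y"
      then have xy: "1 \<le> x" "x \<le> N" "1 \<le> y" "y \<le> N" by (auto simp: klee_residues_def N_def)
      have "N dvd (f y - (y + t)) - (f x - (x + t))"
        by (intro dvd_diff[OF f(3) f(3)])
      then have "N dvd x - y" using \<open>f x = f y\<close> by simp
      then show "x = y" using xy dvd_imp_le_int[of "x - y" N] by (cases "x = y") auto
    qed
  next
    show "f ` {x \<in> klee_residues s n. int (d ^ s) dvd x - a} \<subseteq> {x \<in> klee_residues s n. int (d ^ s) dvd x - a'}"
    proof safe
      fix x assume x: "x \<in> klee_residues s n" "int (d ^ s) dvd x - a"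
      have "int (d ^ s) dvd (f x - (x + t)) + (x - a) + (t - (a' - a))"
        using dvd_trans[OF dN[OF assms(3)] f(3)[of x]] x(2) t_d by (intro dvd_add)
      then show fd: "int (d ^ s) dvd f x - a'" by (simp add: algebra_simps)
      have "\<not> int (p ^ s) dvd f x" if p: "prime p" "p dvd n" for p
      proof
        assume pf: "int (p ^ s) dvd f x"
        show False
        \<comment> \<open>If \<open>p\<close> divides \<open>d\<close>, then \<open>f x\<close> is
          congruent to \<open>a'\<close> modulo \<open>p ^ s\<close>, against the hypothesis on
          \<open>a'\<close>; otherwise it is congruent to \<open>x\<close>, which is a Klee
          residue.\<close>
        proof (cases "p dvd d")
          case True
          then have "int (p ^ s) dvd int (d ^ s)" by (simp only: int_dvd_int_iff dvd_power_same)
          then have "int (p ^ s) dvd f x - (f x - a')"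
            using pf fd by (metis dvd_diff dvd_trans)
          then show False
            using a' True p(1) by (simp add: gen_gcd_eq_1_iff[OF assms(1) d1] del: of_nat_power One_nat_def)
        next
          case False
          have "int (p ^ s) dvd f x - (f x - (x + t)) - t"
            using pf dvd_trans[OF dN[OF p(2)] f(3)[of x]] t_p[OF p False] by (rule dvd_diff[OF dvd_diff])
          then show False
            using x(1) p by (simp add: klee_residues_def gen_gcd_eq_1_iff[OF assms(1,2)] del: of_nat_power One_nat_def)
        qed
      qed
      then show "f x \<in> klee_residues s n"
        using f(1,2)[of x] by (simp add: klee_residues_def gen_gcd_eq_1_iff[OF assms(1,2)] N_def del: of_nat_power One_nat_def)
    qed
  qed simp
qed

text \<open>Reduction modulo \<open>d ^ s\<close> sends Klee residues for \<open>n\<close> to Klee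
  residues for \<open>d\<close>, since primes of \<open>d\<close> divide \<open>n\<close>. The
  fibres partition the residues and all have the size of the class of \<open>a\<close>.\<close>

lemma card_klee_residues_class:
  assumes "s \<ge> 1" "n \<ge> 1" "d dvd n" and a: "gen_gcd s {a, int (d ^ s)} = 1"
  shows "klee s (d ^ s) * card {x \<in> klee_residues s n. int (d ^ s) dvd x - a} = klee s (n ^ s)"
proof -
  define C where "C c = {x \<in> klee_residues s n. int (d ^ s) dvd x - c}" for c
  have d1: "d \<ge> 1" using assms by (cases "d = 0") auto
  have D: "int (d ^ s) > 0" using d1 by simp
  have "klee_residues s n = (\<Union>c\<in>klee_residues s d. C c)"
  proof (intro equalityI subsetI)
    fix x assume x: "x \<in> klee_residues s n"
    define c where "c = (x - 1) mod int (d ^ s) + 1"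
    have c: "1 \<le> c" "c \<le> int (d ^ s)" "int (d ^ s) dvd c - x"
      unfolding c_def using shift_mod_properties[OF D, of x] by auto
    have "\<not> int (p ^ s) dvd c" if p: "prime p" "p dvd d" for p
    proof
      assume "int (p ^ s) dvd c"
      moreover have "int (p ^ s) dvd int (d ^ s)" using p by (simp only: int_dvd_int_iff dvd_power_same)
      ultimately have "int (p ^ s) dvd c - (c - x)" using c(3) by (rule dvd_diff[OF _ dvd_trans])
      then show False
        using x p dvd_trans[OF p(2) assms(3)]
        by (simp add: klee_residues_def gen_gcd_eq_1_iff[OF assms(1,2)] del: of_nat_power One_nat_def)
    qed
    then have "c \<in> klee_residues s d"
      using c by (simp add: klee_residues_def gen_gcd_eq_1_iff[OF assms(1) d1] del: of_nat_power One_nat_def)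
    moreover have "x \<in> C c" using x c(3) by (simp add: C_def dvd_diff_commute)
    ultimately show "x \<in> (\<Union>c\<in>klee_residues s d. C c)" by blast
  qed (auto simp: C_def)
  then have "klee s (n ^ s) = card (\<Union>c\<in>klee_residues s d. C c)" by (simp add: klee_power)
  also have "\<dots> = (\<Sum>c\<in>klee_residues s d. card (C c))"
  proof (rule card_UN_disjoint)
    show "\<forall>c\<in>klee_residues s d. \<forall>c'\<in>klee_residues s d. c \<noteq> c' \<longrightarrow> C c \<inter> C c' = {}"
    proof (intro ballI impI)
      fix c c' assume c: "c \<in> klee_residues s d" "c' \<in> klee_residues s d" "c \<noteq> c'"
      have False if x: "x \<in> C c" "x \<in> C c'" for x
      proof -
        have "int (d ^ s) dvd (x - c') - (x - c)" using x unfolding C_def by (blast intro: dvd_diff)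
        then have "int (d ^ s) dvd c - c'" by simp
        then show False using c dvd_imp_le_int[of "c - c'" "int (d ^ s)"]
          by (auto simp: klee_residues_def)
      qed
      then show "C c \<inter> C c' = {}" by blast
    qed
  qed (auto simp: C_def)
  also have "\<dots> = (\<Sum>c\<in>klee_residues s d. card (C a))"
    unfolding C_def using a
    by (intro sum.cong refl le_antisym card_klee_residues_class_le assms(1-3)) (auto simp: klee_residues_def)
  finally show ?thesis by (simp add: klee_power C_def)
qed

section \<open>Counting tuples and expanding the generalized gcd\<close>

lemma card_multiples:
  assumes "D > 0"
  shows "card {x \<in> {1..int (D * M)}. int D dvd x} = M"
proof -
  have "{x \<in> {1..int (D * M)}. int D dvd x} = (\<lambda>y. int D * y) ` {1..int M}"
    using assms by (auto simp: int_one_le_iff_zero_less zero_less_mult_iff elim!: dvdE)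
  moreover have "inj_on (\<lambda>y. int D * y) {1..int M}" using assms by (auto simp: inj_on_def)
  ultimately show ?thesis by (simp add: card_image)
qed

text \<open>The conditions on different coordinates are independent: the tuples satisfying them form
  a product of sets.\<close>

lemma sum_PiE_of_bool_all:
  fixes P :: "'a \<Rightarrow> 'b \<Rightarrow> bool"
  assumes "finite I" "finite A"
  shows "(\<Sum>m\<in>I \<rightarrow>\<^sub>E A. of_bool (\<forall>i\<in>I. P i (m i))) = (\<Prod>i\<in>I. real (card {x \<in> A. P i x}))"
proof -
  have "(\<Sum>m\<in>I \<rightarrow>\<^sub>E A. of_bool (\<forall>i\<in>I. P i (m i))) = real (card ((I \<rightarrow>\<^sub>E A) \<inter> {m. \<forall>i\<in>I. P i (m i)}))"
    using assms by (simp add: finite_PiE)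
  also have "(I \<rightarrow>\<^sub>E A) \<inter> {m. \<forall>i\<in>I. P i (m i)} = (\<Pi>\<^sub>E i\<in>I. {x \<in> A. P i x})"
    by (auto simp: PiE_iff)
  finally show ?thesis using assms by (simp add: card_PiE)
qed

lemma gen_gcd_eq_sum_klee:
  assumes "s \<ge> 1" "n \<ge> 1"
  shows "real (gen_gcd s (X \<union> {int (n ^ s)}))
       = (\<Sum>d | d dvd n. real (klee s (d ^ s)) * of_bool (\<forall>x\<in>X. int (d ^ s) dvd x))"
proof -
  obtain L where L: "L dvd n" "gen_gcd s (insert (int (n ^ s)) X) = L ^ s"
    "\<And>l. l dvd n \<Longrightarrow> (\<forall>x\<in>X. int (l ^ s) dvd x) \<longleftrightarrow> l dvd L"
    using gen_gcd_root[OF assms] by metis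
  have "L \<ge> 1" using L(1) assms by (cases "L = 0") auto
  have "(\<Sum>d | d dvd n. real (klee s (d ^ s)) * of_bool (\<forall>x\<in>X. int (d ^ s) dvd x))
      = (\<Sum>d | d dvd n. real (klee s (d ^ s)) * of_bool (d dvd L))"
    using L(3) by (intro sum.cong) (auto simp del: of_nat_power)
  also have "\<dots> = (\<Sum>d | d dvd L. real (klee s (d ^ s)))"
    \<comment> \<open>Divisors of \<open>L\<close> are divisors of \<open>n\<close>, so the
      indicator just restricts the range and the divisor sum identity applies to
      \<open>L\<close>.\<close>
    using assms L(1) by (intro sum.mono_neutral_cong_right) (auto intro: dvd_trans)
  also have "\<dots> = real (L ^ s)"
    using sum_klee_divisors[OF assms(1) \<open>L \<ge> 1\<close>] by (simp flip: of_nat_sum)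
  finally show ?thesis using L(2) by simp
qed

section \<open>Evaluation of the sum by exchanging summations\<close>

theorem theorem3p2:
  fixes k r n s :: nat and a :: "nat \<Rightarrow> int"
  assumes "k \<ge> 1" and "r \<ge> 1" and "n \<ge> 1" and "s \<ge> 1"
    and "\<And>i. i \<in> {1..k} \<Longrightarrow> gen_gcd s {a i, int (n ^ s)} = 1"
  shows "(\<Sum>m \<in> {1..k} \<rightarrow>\<^sub>E {x::int. 1 \<le> x \<and> x \<le> int (n ^ s) \<and> gen_gcd s {x, int (n ^ s)} = 1}.
          \<Sum>b \<in> {1..r} \<rightarrow>\<^sub>E {1..int (n ^ s)}.
            real (gen_gcd s ((\<lambda>i. m i - a i) ` {1..k} \<union> b ` {1..r} \<union> {int (n ^ s)})))
       = real (klee s (n ^ s)) ^ k *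
         (\<Sum>d | d \<ge> 1 \<and> d ^ s dvd n ^ s.
            real (d ^ s) ^ r / real (klee s (n ^ s div d ^ s)) ^ (k - 1))"
proof -
  define \<phi> where "\<phi> d = real (klee s (d ^ s))" for d
  define P where "P d m \<longleftrightarrow> (\<forall>i\<in>{1..k}. int (d ^ s) dvd m i - a i)" for d m
  define Q where "Q d b \<longleftrightarrow> (\<forall>j\<in>{1..r}. int (d ^ s) dvd b j)" for d and b :: "nat \<Rightarrow> int"
  let ?M = "{1..k} \<rightarrow>\<^sub>E klee_residues s n" and ?B = "{1..r} \<rightarrow>\<^sub>E {1..int (n ^ s)}"
  have gcd: "real (gen_gcd s ((\<lambda>i. m i - a i) ` {1..k} \<union> b ` {1..r} \<union> {int (n ^ s)}))
      = (\<Sum>d | d dvd n. \<phi> d * of_bool (P d m) * of_bool (Q d b))" for m b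
    unfolding gen_gcd_eq_sum_klee[OF assms(4,3)] P_def Q_def \<phi>_def
    by (intro sum.cong refl) (auto simp del: of_nat_power)
  have "(\<Sum>m\<in>?M. \<Sum>b\<in>?B. \<Sum>d | d dvd n. \<phi> d * of_bool (P d m) * of_bool (Q d b))
      = (\<Sum>m\<in>?M. \<Sum>d | d dvd n. \<Sum>b\<in>?B. \<phi> d * of_bool (P d m) * of_bool (Q d b))"
    by (intro sum.cong refl sum.swap)
  also have "\<dots> = (\<Sum>d | d dvd n. \<Sum>m\<in>?M. \<Sum>b\<in>?B. \<phi> d * of_bool (P d m) * of_bool (Q d b))"
    by (rule sum.swap)
  \<comment> \<open>For fixed \<open>d\<close> the conditions on \<open>m\<close> and on
    \<open>b\<close> are separate factors, so the double sum is a product.\<close>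
  also have "\<dots> = (\<Sum>d | d dvd n. \<phi> d * (\<Sum>m\<in>?M. of_bool (P d m)) * (\<Sum>b\<in>?B. of_bool (Q d b)))"
    by (simp add: mult.assoc sum_product flip: sum_distrib_left)
  also have "\<dots> = (\<Sum>d | d dvd n. \<phi> n ^ k * (real ((n div d) ^ s) ^ r / \<phi> d ^ (k - 1)))"
  proof (rule sum.cong)
    fix d assume "d \<in> {d. d dvd n}"
    then have d: "d dvd n" by simp
    then have d1: "d \<ge> 1" using assms by (cases "d = 0") auto
    have pos: "\<phi> d > 0" unfolding \<phi>_def using klee_power_pos[OF assms(4) d1] by simp
    have "real (card {x \<in> klee_residues s n. int (d ^ s) dvd x - a i}) = \<phi> n / \<phi> d" if i: "i \<in> {1..k}" for i
    proof -
      have "gen_gcd s {a i, int (d ^ s)} = 1"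
        using assms(5)[OF i] d
        unfolding gen_gcd_eq_1_iff[OF assms(4,3)] gen_gcd_eq_1_iff[OF assms(4) d1] by (blast intro: dvd_trans)
      from card_klee_residues_class[OF assms(4,3) d this] show ?thesis
        using pos unfolding \<phi>_def by (simp add: field_simps flip: of_nat_mult)
    qed
    then have M: "(\<Sum>m\<in>?M. of_bool (P d m)) = (\<phi> n / \<phi> d) ^ k"
      unfolding P_def by (subst sum_PiE_of_bool_all) simp_all
    have "n ^ s = d ^ s * (n div d) ^ s" using d by (simp flip: power_mult_distrib)
    then have "card {x \<in> {1..int (n ^ s)}. int (d ^ s) dvd x} = (n div d) ^ s"
      using card_multiples[of "d ^ s" "(n div d) ^ s"] d1 by simp
    then have B: "(\<Sum>b\<in>?B. of_bool (Q d b)) = real ((n div d) ^ s) ^ r"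
      unfolding Q_def by (subst sum_PiE_of_bool_all) (simp_all del: of_nat_power)
    \<comment> \<open>The weight \<open>\<phi> d\<close> cancels one of the \<open>k\<close> factors
      in the denominator, whence the exponent \<open>k - 1\<close>.\<close>
    have "\<phi> d ^ k = \<phi> d * \<phi> d ^ (k - 1)" using assms(1) by (cases k) auto
    then show "\<phi> d * (\<Sum>m\<in>?M. of_bool (P d m)) * (\<Sum>b\<in>?B. of_bool (Q d b))
        = \<phi> n ^ k * (real ((n div d) ^ s) ^ r / \<phi> d ^ (k - 1))"
      unfolding M B using pos by (simp add: power_divide)
  qed simp
  also have "\<dots> = \<phi> n ^ k * (\<Sum>d | d dvd n. real ((n div d) ^ s) ^ r / \<phi> d ^ (k - 1))"
    by (simp only: sum_distrib_left)
  also have "(\<Sum>d | d dvd n. real ((n div d) ^ s) ^ r / \<phi> d ^ (k - 1))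
      = (\<Sum>d | d dvd n. real ((n div (n div d)) ^ s) ^ r / \<phi> (n div d) ^ (k - 1))"
    by (rule sum_divisors_complement[OF assms(3), symmetric])
  also have "\<dots> = (\<Sum>d | d \<ge> 1 \<and> d ^ s dvd n ^ s. real (d ^ s) ^ r / real (klee s (n ^ s div d ^ s)) ^ (k - 1))"
  proof (rule sum.cong)
    \<comment> \<open>For positive \<open>s\<close>, divisibility of s-th powers is divisibility of
      their bases.\<close>
    show "{d. d dvd n} = {d. d \<ge> 1 \<and> d ^ s dvd n ^ s}"
      using assms by (auto simp: Suc_le_eq intro!: Nat.gr0I)
    fix d assume "d \<in> {d. d \<ge> 1 \<and> d ^ s dvd n ^ s}"
    then have "d dvd n" using assms by simp
    then show "real ((n div (n div d)) ^ s) ^ r / \<phi> (n div d) ^ (k - 1)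
        = real (d ^ s) ^ r / real (klee s (n ^ s div d ^ s)) ^ (k - 1)"
      using assms by (auto simp: \<phi>_def div_power)
  qed
  finally show ?thesis
    unfolding gcd unfolding \<phi>_def klee_residues_def .
qed

end
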